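(* Let $f\in C_{\mathbb R}(X)$ and let $x,y\in X$ be such that $$u=\lim_{k\to\infty}\operatorname{Avg}_{F_k}f(x),\qquad v=\lim_{k\to\infty}\operatorname{Avg}_{F_k}f(y)$$ exist, where $u\le v$. Suppose $\mathcal K\subseteq[u,v]$ is a nonempty compact subset. Let $\mu$ be a fully supported Borel probability measure on $X$ that neglects shells. Then there exist sequences $(r_k)_{k=1}^\infty,(s_k)_{k=1}^\infty$ of positive numbers such that $$\mathcal K=\operatorname{LS}\left(\left(\alpha_{B(x,y;r_k,s_k)}\left(\operatorname{Avg}_{F_k}f\right)\right)_{k=1}^\infty\right).$$
   Context: $(X,\rho)$ is a compact metric space, $C_{\mathbb R}(X)$ is the space of real-valued continuous functions on $X$, $G$ is a discrete monoid, and $T:G\curvearrowright X$ is a left action by continuous maps $(T_g)_{g\in G}$ ($T_{g_1}\circ T_{g_2}=T_{g_1g_2}$, $T_{1_G}=\mathrm{id}_X$). $(F_k)_{k=1}^\infty$ is a sequence of nonempty finite subsets of $G$. $\operatorname{Avg}_Ff:=\frac1{|F|}\sum_{g\in F}f\circ T_g$. For $r,s>0$, $B(x;r)=\{z\in X:\rho(x,z)<r\}$ and $B(x,y;r,s)=B(x;r)\cup B(y;s)$. For a measurable $E\subseteq X$ with $\mu(E)>0$, $\alpha_E(f):=\frac1{\mu(E)}\int_Ef\,\mathrm d\mu$. $\mu$ neglects shells if $\mu(\{y\in X:\rho(x,y)=r\})=0$ for all $x\in X$, $r\in[0,\infty)$. For a sequence $(z_k)_{k=1}^\infty$ in a topological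 space, $\operatorname{LS}((z_k)_{k=1}^\infty)$ is the set of all limits of convergent subsequences: $\{\lim_{\ell\to\infty}z_{k_\ell}:k_1<k_2<\cdots,\ \lim_{\ell\to\infty}z_{k_\ell}\text{ exists}\}$. *)

theory Defs
  imports "HOL-Analysis.Analysis" "HOL-Probability.Probability_Measure"
begin

text \<open>
  The compact metric space is a type of class \<open>metric_space\<close> whose universe is compact; the
  discrete monoid is a type of class \<open>monoid_mult\<close>.
\<close>

definition continuous_left_action :: "('g :: monoid_mult \<Rightarrow> 'a :: topological_space \<Rightarrow> 'a) \<Rightarrow> bool" where
  "continuous_left_action T \<longleftrightarrow>
     (\<forall>g. continuous_on UNIV (T g)) \<and>
     T 1 = id \<and>
     (\<forall>g h. T g \<circ> T h = T (g * h))"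

definition Avg :: "('g \<Rightarrow> 'a \<Rightarrow> 'a) \<Rightarrow> 'g set \<Rightarrow> ('a \<Rightarrow> real) \<Rightarrow> 'a \<Rightarrow> real" where
  "Avg T F f = (\<lambda>x. 1 / real (card F) * (\<Sum>g\<in>F. (f \<circ> T g) x))"

definition ball2 :: "'a :: metric_space \<Rightarrow> 'a \<Rightarrow> real \<Rightarrow> real \<Rightarrow> 'a set" where
  "ball2 x y r s = ball x r \<union> ball y s"

text \<open>Only meaningful for measurable \<open>E\<close> of positive measure; otherwise a junk value.\<close>

definition set_mean :: "'a measure \<Rightarrow> 'a set \<Rightarrow> ('a \<Rightarrow> real) \<Rightarrow> real" where
  "set_mean \<mu> E f = 1 / measure \<mu> E * (LINT z:E|\<mu>. f z)"

definition borel_probability :: "'a :: topological_space measure \<Rightarrow> bool" where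
  "borel_probability \<mu> \<longleftrightarrow> prob_space \<mu> \<and> sets \<mu> = sets borel"

definition fully_supported :: "'a :: topological_space measure \<Rightarrow> bool" where
  "fully_supported \<mu> \<longleftrightarrow> (\<forall>U. open U \<longrightarrow> U \<noteq> {} \<longrightarrow> measure \<mu> U > 0)"

definition neglects_shells :: "'a :: metric_space measure \<Rightarrow> bool" where
  "neglects_shells \<mu> \<longleftrightarrow> (\<forall>x. \<forall>r\<ge>0. measure \<mu> {y. dist x y = r} = 0)"

definition LS :: "(nat \<Rightarrow> 'a :: topological_space) \<Rightarrow> 'a set" where
  "LS z = {l. \<exists>\<phi> :: nat \<Rightarrow> nat. strict_mono \<phi> \<and> (\<lambda>i. z (\<phi> i)) \<longlonglongrightarrow> l}"

end

theory Submission
  imports Defs "HOL-Probability.Distribution_Functions"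
begin

text \<open>
  Near \<open>x\<close> and \<open>y\<close> the continuous function \<open>Avg T (F k) f\<close> is almost constant, so its mean over two
  small disjoint balls is almost a convex combination of its values at \<open>x\<close> and \<open>y\<close>, weighted by the
  measures of the balls. As \<open>\<mu>\<close> neglects shells, the measure of a ball depends continuously on its
  radius, hence the weights can be prescribed and the means can follow any sequence in \<open>{u..v}\<close> up
  to an error tending to zero. One follows a sequence in \<open>K\<close> that visits each point of a countable
  dense subset of \<open>K\<close> infinitely often.
\<close>

section \<open>Sets of subsequential limits\<close>

text \<open>If every ball around \<open>l\<close> is visited beyond every index, a strictly
  increasing choice of indices with errors below \<open>1 / Suc n\<close> yields the subsequence.
  This form mentions no subsequence, so it is easy to check after a perturbation.\<close>

lemma LS_iff_frequently:
  fixes z :: "nat \<Rightarrow> 'a :: metric_space"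
  shows "l \<in> LS z \<longleftrightarrow> (\<forall>e>0. \<exists>\<^sub>F k in sequentially. dist (z k) l < e)"
proof
  assume "l \<in> LS z"
  then obtain \<phi> :: "nat \<Rightarrow> nat" where \<phi>: "strict_mono \<phi>" "(\<lambda>i. z (\<phi> i)) \<longlonglongrightarrow> l"
    by (auto simp: LS_def)
  show "\<forall>e>0. \<exists>\<^sub>F k in sequentially. dist (z k) l < e"
  proof (intro allI impI)
    fix e :: real assume "e > 0"
    with \<phi>(2) obtain N where N: "\<And>n. n \<ge> N \<Longrightarrow> dist (z (\<phi> n)) l < e"
      unfolding lim_sequentially by blast
    have "\<exists>k\<ge>n. dist (z k) l < e" for n
      using N[of "max n N"] seq_suble[OF \<phi>(1), of "max n N"]
      by (intro exI[of _ "\<phi> (max n N)"]) auto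
    then show "\<exists>\<^sub>F k in sequentially. dist (z k) l < e"
      by (simp add: frequently_sequentially)
  qed
next
  assume *: "\<forall>e>0. \<exists>\<^sub>F k in sequentially. dist (z k) l < e"
  have ex: "\<exists>k\<ge>N. dist (z k) l < 1 / real (Suc n)" for N n
    using * by (simp add: frequently_sequentially)
  have "\<exists>\<phi>. \<forall>n. dist (z (\<phi> n)) l < 1 / real (Suc n) \<and> \<phi> n < \<phi> (Suc n)"
  proof (rule dependent_nat_choice)
    show "\<exists>k. dist (z k) l < 1 / real (Suc 0)"
      using ex by blast
    show "\<exists>k'. dist (z k') l < 1 / real (Suc (Suc n)) \<and> k < k'" for k n
      using ex[of "Suc k" "Suc n"] by (auto simp: Suc_le_eq)
  qed
  then obtain \<phi> where \<phi>: "\<And>n. dist (z (\<phi> n)) l < 1 / real (Suc n)" "\<And>n. \<phi> n < \<phi> (Suc n)"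
    by blast
  have "(\<lambda>n. dist (z (\<phi> n)) l) \<longlonglongrightarrow> 0"
    by (rule real_tendsto_sandwich[OF _ _ tendsto_const LIMSEQ_Suc[OF lim_1_over_n]])
      (use less_imp_le[OF \<phi>(1)] in \<open>auto intro!: always_eventually simp del: of_nat_Suc\<close>)
  then show "l \<in> LS z"
    using \<phi>(2) by (auto simp: LS_def strict_mono_Suc_iff tendsto_dist_iff[symmetric])
qed

lemma LS_subset_LS:
  fixes a b :: "nat \<Rightarrow> 'a :: metric_space"
  assumes "(\<lambda>k. dist (a k) (b k)) \<longlonglongrightarrow> 0"
  shows "LS a \<subseteq> LS b"
proof
  fix l assume l: "l \<in> LS a"
  have "\<exists>\<^sub>F k in sequentially. dist (b k) l < e" if "e > 0" for e
  proof -
    have "\<exists>\<^sub>F k in sequentially. dist (a k) l < e / 2"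
      using l half_gt_zero[OF that] unfolding LS_iff_frequently by blast
    moreover have "\<forall>\<^sub>F k in sequentially. dist (a k) (b k) < e / 2"
      by (rule order_tendstoD(2)[OF assms half_gt_zero[OF that]])
    ultimately show ?thesis
      by (rule frequently_elim1[OF frequently_eventually_conj]) (use dist_triangle_half_r in blast)
  qed
  then show "l \<in> LS b"
    by (simp add: LS_iff_frequently)
qed

text \<open>The means need only follow a prescribed sequence up to a null error; their limit set is
  then the prescribed one.\<close>

lemma LS_eq_LS:
  fixes a b :: "nat \<Rightarrow> 'a :: metric_space"
  assumes "(\<lambda>k. dist (a k) (b k)) \<longlonglongrightarrow> 0"
  shows "LS a = LS b"
  using LS_subset_LS[OF assms] LS_subset_LS[of b a] assms by (auto simp: dist_commute)

lemma closed_eq_LS: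
  fixes K :: "'a :: {metric_space, second_countable_topology} set"
  assumes "closed K" "K \<noteq> {}"
  obtains w where "\<And>k. w k \<in> K" "LS w = K"
proof -
  obtain D where D: "countable D" "D \<subseteq> K" "K \<subseteq> closure D"
    using separable[of K] by blast
  then have "D \<noteq> {}"
    using \<open>K \<noteq> {}\<close> by auto
  \<comment> \<open>each value of the enumeration of \<open>D\<close> is repeated infinitely often\<close>
  define w where "w k = from_nat_into D (fst (prod_decode k))" for k
  have wK: "w k \<in> K" for k
    using D \<open>D \<noteq> {}\<close> by (auto simp: w_def intro: from_nat_into)
  moreover have "LS w \<subseteq> K"
    using closed_sequentially[OF \<open>closed K\<close>] wK by (fastforce simp: LS_def)
  moreover have "K \<subseteq> LS w"
    unfolding LS_iff_frequently subset_iff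
  proof (intro allI impI)
    fix l and e :: real assume "l \<in> K" "e > 0"
    then obtain d where d: "d \<in> D" "dist d l < e"
      using D(3) closure_approachable by blast
    then obtain i where i: "from_nat_into D i = d"
      using from_nat_into_surj[OF D(1)] by blast
    have "\<exists>k\<ge>n. dist (w k) l < e" for n
      \<comment> \<open>\<open>prod_encode (i, n)\<close> is an index that is at least
        \<open>n\<close> and has first component \<open>i\<close>, so \<open>w\<close> takes the
        value \<open>d\<close> there.\<close>
      using d i by (intro exI[of _ "prod_encode (i, n)"]) (auto simp: w_def le_prod_encode_2)
    then show "\<exists>\<^sub>F k in sequentially. dist (w k) l < e"
      by (simp add: frequently_sequentially)
  qed
  ultimately show ?thesis
    using that by blast
qed

section \<open>Measure of a ball as a function of its radius\<close>

text \<open>The distribution function of \<open>dist x\<close> measures closed balls, and these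
  differ from open balls by a null shell. For \<open>r = 0\<close> the shell is the point
  \<open>x\<close> itself.\<close>

lemma measure_ball_eq_cdf:
  assumes "borel_probability \<mu>" "neglects_shells \<mu>" "r \<ge> 0"
  shows "measure \<mu> (ball x r) = cdf (distr \<mu> borel (dist x)) r"
proof -
  interpret prob_space \<mu>
    using assms by (simp add: borel_probability_def)
  have [measurable_cong]: "sets \<mu> = sets borel"
    using assms by (simp add: borel_probability_def)
  have [simp]: "space \<mu> = UNIV"
    using sets_eq_imp_space_eq[OF \<open>sets \<mu> = sets borel\<close>] by simp
  have [measurable]: "dist x \<in> borel_measurable borel"
    by (intro borel_measurable_continuous_onI continuous_on_dist continuous_on_const continuous_on_id)
  have "dist x -` {..r} = cball x r"
    by auto
  then have "cdf (distr \<mu> borel (dist x)) r = measure \<mu> (cball x r)"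
    by (simp add: cdf_def measure_distr)
  also have "cball x r = ball x r \<union> {y. dist x y = r}"
    by auto
  also have "measure \<mu> \<dots> = measure \<mu> (ball x r) + measure \<mu> {y. dist x y = r}"
    by (intro finite_measure_Union) (auto simp: \<open>sets \<mu> = sets borel\<close>)
  also have "measure \<mu> {y. dist x y = r} = 0"
    using assms by (simp add: neglects_shells_def)
  finally show ?thesis
    by simp
qed

text \<open>A distribution function is continuous wherever its law has no atom, and the atoms of the
  law of \<open>dist x\<close> would be shells of positive measure.\<close>

lemma continuous_on_measure_ball:
  fixes \<mu> :: "'a :: metric_space measure"
  assumes "borel_probability \<mu>" "neglects_shells \<mu>"
  shows "continuous_on {0..} (\<lambda>r. measure \<mu> (ball x r))"
proof -
  have sets: "sets \<mu> = sets borel" and "prob_space \<mu>"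
    using assms by (simp_all add: borel_probability_def)
  interpret prob_space \<mu> by fact
  note [measurable_cong] = sets
  have [simp]: "space \<mu> = UNIV"
    using sets_eq_imp_space_eq[OF sets] by simp
  have [measurable]: "dist x \<in> borel_measurable borel" for x :: 'a
    by (intro borel_measurable_continuous_onI continuous_on_dist continuous_on_const continuous_on_id)
  interpret D: real_distribution "distr \<mu> borel (dist x)"
    by (intro real_distribution_distr) measurable
  have "isCont (cdf (distr \<mu> borel (dist x))) r" if "r \<ge> 0" for r
  proof -
    have "dist x -` {r} = {y. dist x y = r}"
      by auto
    then show ?thesis
      using assms that by (simp add: D.isCont_cdf measure_distr neglects_shells_def)
  qed
  then have "continuous_on {0..} (cdf (distr \<mu> borel (dist x)))"
    by (simp add: continuous_at_imp_continuous_on)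
  then show ?thesis
    by (rule continuous_on_eq) (simp add: measure_ball_eq_cdf[OF assms])
qed

text \<open>The intermediate value theorem applies between radius \<open>0\<close>, where the open
  ball is empty, and \<open>\<delta>\<close>. Since \<open>p\<close> is positive, the radius found
  is not \<open>0\<close>.\<close>

lemma obtain_ball_of_measure:
  assumes "borel_probability \<mu>" "neglects_shells \<mu>"
    and "0 < p" "p \<le> measure \<mu> (ball x \<delta>)" "0 \<le> \<delta>"
  obtains r where "0 < r" "r \<le> \<delta>" "measure \<mu> (ball x r) = p"
proof -
  have "continuous_on {0..\<delta>} (\<lambda>r. measure \<mu> (ball x r))"
    by (rule continuous_on_subset[OF continuous_on_measure_ball[OF assms(1,2)]]) auto
  with assms(3-5) obtain r where "0 \<le> r" "r \<le> \<delta>" "measure \<mu> (ball x r) = p"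
    using IVT'[of "\<lambda>r. measure \<mu> (ball x r)" 0 p \<delta>] by auto
  moreover from this have "r \<noteq> 0"
    using \<open>0 < p\<close> by auto
  ultimately show ?thesis
    using that by (auto simp: order_le_less)
qed

section \<open>Means of almost constant functions\<close>

lemma (in finite_measure)
  fixes h :: "'a \<Rightarrow> real"
  assumes h: "h \<in> borel_measurable M" and A: "A \<in> sets M"
    and close: "\<And>z. z \<in> A \<Longrightarrow> \<bar>h z - c\<bar> \<le> e"
  shows set_integrable_near_const: "set_integrable M A h"
    and set_integral_near_const: "\<bar>(LINT z:A|M. h z) - c * measure M A\<bar> \<le> e * measure M A"
proof -
  have diff: "set_integrable M A (\<lambda>z. h z - c)"
    unfolding set_integrable_def
  \<comment> \<open>The bound is \<open>\<bar>e\<bar>\<close> because the integrand is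
    \<open>0\<close> off \<open>A\<close>, and \<open>e\<close> may be negative when
    \<open>A\<close> is empty.\<close>
  proof (rule integrable_const_bound[where B = "\<bar>e\<bar>"])
    show "AE z in M. norm (indicat_real A z *\<^sub>R (h z - c)) \<le> \<bar>e\<bar>"
      using close by (intro AE_I2) (fastforce simp: indicator_def)
  qed (use h A in measurable)
  have const: "set_integrable M A (\<lambda>_. b)" for b :: real
    using A by (simp add: set_integrable_def less_top[symmetric])
  have *: "(LINT z:A|M. b) = b * measure M A" for b :: real
    using A by (simp add: set_lebesgue_integral_def)
  show int: "set_integrable M A h"
    using set_integral_add(1)[OF diff const[of c]] by simp
  have "(LINT z:A|M. h z - c) \<le> (LINT z:A|M. e)"
    using close by (intro set_integral_mono diff const) (simp add: abs_le_iff)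
  moreover have "(LINT z:A|M. - e) \<le> (LINT z:A|M. h z - c)"
    using close by (intro set_integral_mono diff const) (fastforce simp: abs_le_iff)
  ultimately show "\<bar>(LINT z:A|M. h z) - c * measure M A\<bar> \<le> e * measure M A"
    by (simp add: set_integral_diff(2)[OF int const] *)
qed

text \<open>This serves the degenerate case in which both balls have the same centre.\<close>

lemma set_mean_near_const:
  assumes "finite_measure \<mu>" "h \<in> borel_measurable \<mu>" "A \<in> sets \<mu>" "measure \<mu> A > 0"
    and "\<And>z. z \<in> A \<Longrightarrow> \<bar>h z - c\<bar> \<le> e"
  shows "\<bar>set_mean \<mu> A h - c\<bar> \<le> e"
proof -
  have "\<bar>(LINT z:A|\<mu>. h z) - c * measure \<mu> A\<bar> \<le> e * measure \<mu> A"
    using assms by (intro finite_measure.set_integral_near_const)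
  with assms(4) show ?thesis
    by (simp add: set_mean_def abs_le_iff field_simps)
qed

text \<open>The sets carry the shares \<open>1 - t\<close> and \<open>t\<close> of the total measure
  \<open>m\<close>. The two integral errors add up to at most \<open>e * m\<close>, and division by
  \<open>m\<close> leaves \<open>e\<close>.\<close>

lemma set_mean_Un_near_convex:
  assumes "finite_measure \<mu>" and h: "h \<in> borel_measurable \<mu>"
    and sets: "A \<in> sets \<mu>" "B \<in> sets \<mu>" and "A \<inter> B = {}"
    and m: "m > 0" "measure \<mu> A = (1 - t) * m" "measure \<mu> B = t * m"
    and A: "\<And>z. z \<in> A \<Longrightarrow> \<bar>h z - a\<bar> \<le> e"
    and B: "\<And>z. z \<in> B \<Longrightarrow> \<bar>h z - b\<bar> \<le> e"
  shows "\<bar>set_mean \<mu> (A \<union> B) h - ((1 - t) * a + t * b)\<bar> \<le> e"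
proof -
  interpret finite_measure \<mu> by fact
  have "measure \<mu> (A \<union> B) = m"
    using finite_measure_Union[OF sets \<open>A \<inter> B = {}\<close>] m by (simp add: algebra_simps)
  moreover have "(LINT z:A \<union> B|\<mu>. h z) = (LINT z:A|\<mu>. h z) + (LINT z:B|\<mu>. h z)"
    by (intro set_integral_Un \<open>A \<inter> B = {}\<close> set_integrable_near_const[OF h sets(1) A]
        set_integrable_near_const[OF h sets(2) B])
  moreover have "\<bar>(LINT z:A|\<mu>. h z) - a * ((1 - t) * m)\<bar> \<le> e * ((1 - t) * m)"
    using set_integral_near_const[OF h sets(1) A] m by simp
  moreover have "\<bar>(LINT z:B|\<mu>. h z) - b * (t * m)\<bar> \<le> e * (t * m)"
    using set_integral_near_const[OF h sets(2) B] m by simp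
  ultimately have "\<bar>(LINT z:A \<union> B|\<mu>. h z) - ((1 - t) * a + t * b) * m\<bar> \<le> e * m"
    and "measure \<mu> (A \<union> B) = m"
    unfolding abs_le_iff by (simp_all add: algebra_simps)
  then show ?thesis
    using \<open>m > 0\<close> by (simp add: set_mean_def abs_le_iff field_simps)
qed

section \<open>Convex combinations as means over two balls\<close>

lemma continuous_on_Avg:
  assumes "continuous_left_action T" "continuous_on UNIV f"
  shows "continuous_on UNIV (Avg T F f)"
proof -
  have "continuous_on UNIV (\<lambda>z. f (T g z))" for g
    using assms continuous_on_compose2[of UNIV f UNIV "T g"]
    by (auto simp: continuous_left_action_def)
  then show ?thesis
    unfolding Avg_def comp_def by (intro continuous_intros)
qed

lemma continuous_ball_near:
  fixes h :: "'a :: metric_space \<Rightarrow> real"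
  assumes "continuous_on UNIV h" "e > 0"
  obtains d where "d > 0" "\<And>z. z \<in> ball x d \<Longrightarrow> \<bar>h z - h x\<bar> \<le> e"
proof -
  from assms obtain d where "d > 0" "\<And>z. dist z x < d \<Longrightarrow> dist (h z) (h x) < e"
    by (force simp: continuous_on_iff)
  then show ?thesis
    using that[of d] by (force simp: dist_real_def dist_commute)
qed

lemma ball2_mean_approx:
  fixes h :: "'a :: metric_space \<Rightarrow> real"
  assumes \<mu>: "borel_probability \<mu>" "fully_supported \<mu>" "neglects_shells \<mu>"
    and h: "continuous_on UNIV h" and "e > 0" and t: "0 < t" "t < 1"
  obtains r s where "r > 0" "s > 0"
    "\<bar>set_mean \<mu> (ball2 x y r s) h - ((1 - t) * h x + t * h y)\<bar> \<le> e"
proof -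
  interpret prob_space \<mu>
    using \<mu> by (simp add: borel_probability_def)
  have sets: "sets \<mu> = sets borel"
    using \<mu> by (simp add: borel_probability_def)
  have meas: "h \<in> borel_measurable \<mu>"
    using borel_measurable_continuous_onI[OF h] by (simp cong: measurable_cong_sets add: sets)
  note fin = finite_measure_axioms
  have pos: "measure \<mu> (ball z d) > 0" if "d > 0" for z d
    using \<mu>(2) that by (auto simp: fully_supported_def)
  obtain dx where dx: "dx > 0" "\<And>z. z \<in> ball x dx \<Longrightarrow> \<bar>h z - h x\<bar> \<le> e"
    using continuous_ball_near[OF h \<open>e > 0\<close>] by blast
  obtain dy where dy: "dy > 0" "\<And>z. z \<in> ball y dy \<Longrightarrow> \<bar>h z - h y\<bar> \<le> e"
    using continuous_ball_near[OF h \<open>e > 0\<close>] by blast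
  show ?thesis
  proof (cases "x = y")
    \<comment> \<open>Balls around the same point cannot be disjoint, but here the convex
      combination is \<open>h x\<close> for every \<open>t\<close>, and one ball used twice
      suffices.\<close>
    case True
    have "\<bar>set_mean \<mu> (ball x dx) h - h x\<bar> \<le> e"
      using dx pos by (intro set_mean_near_const fin meas) (auto simp: sets)
    with True dx(1) show ?thesis
      using that[of dx dx] by (simp add: ball2_def algebra_simps)
  next
    case False
    \<comment> \<open>Radii up to \<open>d\<close> keep \<open>h\<close> within \<open>e\<close> of
      its value at either centre and, being at most half the distance of the centres, make the balls
      disjoint.\<close>
    define d where "d = min (min dx dy) (dist x y / 2)"
    have d: "d > 0" "d \<le> dx" "d \<le> dy" "2 * d \<le> dist x y"
      using dx dy False by (auto simp: d_def)
    \<comment> \<open>With the smaller of the two measures as total mass, both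
      \<open>(1 - t) * m\<close> and \<open>t * m\<close> are attained by balls of radius at most
      \<open>d\<close>.\<close>
    define m where "m = min (measure \<mu> (ball x d)) (measure \<mu> (ball y d))"
    have m: "m > 0" "m \<le> measure \<mu> (ball x d)" "m \<le> measure \<mu> (ball y d)"
      using pos d(1) by (auto simp: m_def)
    have tm: "(1 - t) * m \<le> m" "t * m \<le> m" "(1 - t) * m > 0" "t * m > 0"
      using t m(1) by (auto simp: mult_le_cancel_right1 mult_le_cancel_right2)
    obtain r where r: "0 < r" "r \<le> d" "measure \<mu> (ball x r) = (1 - t) * m"
      using obtain_ball_of_measure[OF \<mu>(1,3), of "(1 - t) * m" x d] tm m d by auto
    obtain s where s: "0 < s" "s \<le> d" "measure \<mu> (ball y s) = t * m"
      using obtain_ball_of_measure[OF \<mu>(1,3), of "t * m" y d] tm m d by auto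
    have "ball x r \<inter> ball y s = {}"
      using r s d(4) by (intro disjoint_ballI) auto
    then have "\<bar>set_mean \<mu> (ball x r \<union> ball y s) h - ((1 - t) * h x + t * h y)\<bar> \<le> e"
      using r s d dx dy m(1)
      by (intro set_mean_Un_near_convex[where m = m] fin meas) (auto simp: sets)
    then show ?thesis
      using that[of r s] r s by (simp add: ball2_def)
  qed
qed

text \<open>If \<open>u < v\<close>, the end points \<open>w = u\<close> and \<open>w = v\<close>
  would need the weights \<open>0\<close> and \<open>1\<close>, for which one ball would have
  measure zero. The error \<open>e * (v - u)\<close> pays for weights strictly between.\<close>

lemma convex_combination_between:
  fixes u v w e :: real
  assumes "w \<in> {u..v}" "0 < e" "e < 1"
  obtains t where "0 < t" "t < 1" "\<bar>(1 - t) * u + t * v - w\<bar> \<le> e * (v - u)"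
proof -
  have "w \<in> closed_segment u v"
    using assms(1) by (auto simp: closed_segment_eq_real_ivl)
  then obtain l where l: "0 \<le> l" "l \<le> 1" "w = (1 - l) * u + l * v"
    by (auto simp: in_segment)
  \<comment> \<open>pushes \<open>l\<close> towards \<open>1/2\<close>, away from the forbidden end points\<close>
  define t where "t = (1 - e) * l + e / 2"
  have "(1 - e) * l \<le> 1 - e" "(1 - e) * l \<ge> 0"
    using assms l by (auto simp: mult_left_le)
  then have t: "0 < t" "t < 1"
    using assms(2,3) unfolding t_def by linarith+
  \<comment> \<open>The left side is \<open>(t - l) * (v - u)\<close>, and
    \<open>t - l = e * (1 / 2 - l)\<close>.\<close>
  have "(1 - t) * u + t * v - w = e * ((1 / 2 - l) * (v - u))"
    by (simp add: t_def l(3) field_simps)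
  moreover have "\<bar>(1 / 2 - l) * (v - u)\<bar> \<le> 1 * (v - u)"
    unfolding abs_mult using assms(1) l by (intro mult_mono) auto
  ultimately show ?thesis
    using that[OF t] assms(2) by (simp add: abs_mult)
qed

section \<open>Choice of the radii along the sequence\<close>

theorem theorem4p4:
  fixes T :: "'g :: monoid_mult \<Rightarrow> 'a :: metric_space \<Rightarrow> 'a"
    and F :: "nat \<Rightarrow> 'g set"
    and f :: "'a \<Rightarrow> real"
    and x y :: 'a
    and u v :: real
    and K :: "real set"
    and \<mu> :: "'a measure"
  assumes "compact (UNIV :: 'a set)"
    and "continuous_left_action T"
    and "\<And>k. finite (F k)" and "\<And>k. F k \<noteq> {}"
    and "continuous_on UNIV f"
    and "(\<lambda>k. Avg T (F k) f x) \<longlonglongrightarrow> u"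
    and "(\<lambda>k. Avg T (F k) f y) \<longlonglongrightarrow> v"
    and "u \<le> v"
    and "K \<subseteq> {u..v}" and "K \<noteq> {}" and "compact K"
    and "borel_probability \<mu>" and "fully_supported \<mu>" and "neglects_shells \<mu>"
  shows "\<exists>r s :: nat \<Rightarrow> real. (\<forall>k. r k > 0) \<and> (\<forall>k. s k > 0) \<and>
           K = LS (\<lambda>k. set_mean \<mu> (ball2 x y (r k) (s k)) (Avg T (F k) f))"
proof -
  let ?h = "\<lambda>k. Avg T (F k) f"
  obtain w where w: "\<And>k. w k \<in> K" "LS w = K"
    using closed_eq_LS compact_imp_closed[OF \<open>compact K\<close>] \<open>K \<noteq> {}\<close> by blast
  \<comment> \<open>The double \<open>Suc\<close> keeps \<open>e k\<close> strictly below
    \<open>1\<close> also for \<open>k = 0\<close>, as the choice of the weight \<open>t\<close>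
    requires.\<close>
  define e where "e k = 1 / real (Suc (Suc k))" for k
  \<comment> \<open>The summands bound, in order, the oscillation of the average on the balls, its
    distance at \<open>x\<close> and at \<open>y\<close> from the limits \<open>u\<close> and
    \<open>v\<close>, and the shift of the weight away from \<open>0\<close> and
    \<open>1\<close>.\<close>
  define err where "err k = e k + \<bar>?h k x - u\<bar> + \<bar>?h k y - v\<bar> + e k * (v - u)" for k
  have "\<exists>r s. r > 0 \<and> s > 0 \<and> \<bar>set_mean \<mu> (ball2 x y r s) (?h k) - w k\<bar> \<le> err k" for k
  proof -
    have e: "0 < e k" "e k < 1"
      by (auto simp: e_def)
    have "w k \<in> {u..v}"
      using w(1) \<open>K \<subseteq> {u..v}\<close> by blast
    then obtain t where t: "0 < t" "t < 1" "\<bar>(1 - t) * u + t * v - w k\<bar> \<le> e k * (v - u)"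
      using convex_combination_between e by blast
    have "continuous_on UNIV (?h k)"
      using assms by (intro continuous_on_Avg)
    then obtain r s where rs: "r > 0" "s > 0"
        "\<bar>set_mean \<mu> (ball2 x y r s) (?h k) - ((1 - t) * ?h k x + t * ?h k y)\<bar> \<le> e k"
      using ball2_mean_approx assms(12-14) e(1) t(1,2) by blast
    have "\<bar>(1 - t) * (?h k x - u)\<bar> \<le> \<bar>?h k x - u\<bar>" "\<bar>t * (?h k y - v)\<bar> \<le> \<bar>?h k y - v\<bar>"
      using t by (auto simp: abs_mult mult_left_le_one_le)
    then have "\<bar>set_mean \<mu> (ball2 x y r s) (?h k) - w k\<bar> \<le> err k"
      using rs(3) t(3) unfolding err_def by (simp add: algebra_simps)
    with rs show ?thesis
      by blast
  qed
  then obtain r s where rs: "\<And>k. r k > 0" "\<And>k. s k > 0"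
      "\<And>k. \<bar>set_mean \<mu> (ball2 x y (r k) (s k)) (?h k) - w k\<bar> \<le> err k"
    by metis
  have "e \<longlonglongrightarrow> 0"
    unfolding e_def by (intro LIMSEQ_Suc lim_1_over_n)
  then have "err \<longlonglongrightarrow> 0 + \<bar>u - u\<bar> + \<bar>v - v\<bar> + 0 * (v - u)"
    unfolding err_def by (intro tendsto_intros assms)
  then have "err \<longlonglongrightarrow> 0"
    by simp
  then have "(\<lambda>k. dist (set_mean \<mu> (ball2 x y (r k) (s k)) (?h k)) (w k)) \<longlonglongrightarrow> 0"
    by (rule Lim_null_comparison[rotated]) (simp add: dist_real_def rs(3))
  then have "LS (\<lambda>k. set_mean \<mu> (ball2 x y (r k) (s k)) (?h k)) = K"
    unfolding w(2)[symmetric] by (rule LS_eq_LS)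
  with rs(1,2) show ?thesis
    by (intro exI[of _ r] exI[of _ s]) simp
qed

end
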